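(* Over an alphabet containing at least four distinct characters, there exists a family of strings $T_m$ ($m \geq 1$), with $n = |T_m| \to \infty$, such that the total work of leftward online construction of the CDAWG, i.e. of building $\mathrm{CDAWG}(T_m[i..n])$ for decreasing $i = n, \ldots, 1$, is $\Omega(n^2)$; specifically, $\sum_{i=1}^{n-1} \left| \mathsf{e}(T_m[i..n]) - \mathsf{e}(T_m[i+1..n]) \right| = \Omega(n^2)$.
   Context: Strings are finite sequences of characters from an alphabet $\Sigma$; $\varepsilon$ is the empty string, $T[i..j]=T[i]\cdots T[j]$. For a string $T$, $\mathrm{Substr}(T)$ is its set of substrings (including $\varepsilon$). A substring $u$ of $T$ is left-maximal in $T$ if $u$ is a prefix of $T$ or there are distinct characters $c \neq d$ with $cu, du \in \mathrm{Substr}(T)$; it is right-maximal in $T$ if $u$ is a suffix of $T$ or there are distinct characters $c\neq d$ with $uc, ud \in \mathrm{Substr}(T)$. $\mathsf{M}(T)$ is the set of substrings of $T$ that are both left- and right-maximal (it contains $\varepsilon$ and $T$). The compact directed acyclic word graph $\mathrm{CDAWG}(T)$ has exactly one node for each element of $\mathsf{M}(T)$, and the outgoing edges of the node $x$ are in bijection with the characters $c$ such that $xc \in \mathrm{Substr}(T)$. For a string $w$, $d_T(w)$ is the number of distinct characters $c$ with $wc \in \mathrm{Substr}(T)$. The size of the CDAWG is $\mathsf{e}(T) = \sum_{x \in \mathsf{M}(T)} d_T(x)$, its number of edges. In leftward online construction the CDAWG of $T[i+1..n]$ is updated to the CDAWG of $T[i..n]$; the work of each update is at least the number of edges that must be added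 or removed, which is at least $|\mathsf{e}(T[i..n]) - \mathsf{e}(T[i+1..n])|$. *)

theory Defs
  imports Complex_Main "HOL-Library.Sublist" "HOL-Library.Landau_Symbols"
begin

text \<open>The factor $T[i..j]$ with 1-based positions; it is empty when $j < i$, so
  $T[n+1..n] = \varepsilon$ for $n = |T|$.\<close>

definition factor :: "'a list \<Rightarrow> nat \<Rightarrow> nat \<Rightarrow> 'a list" where
  "factor T i j = take (Suc j - i) (drop (i - 1) T)"

definition Substr :: "'a list \<Rightarrow> 'a list set" where
  "Substr T = {u. sublist u T}"

definition left_maximal :: "'a list \<Rightarrow> 'a list \<Rightarrow> bool" where
  "left_maximal T u \<longleftrightarrow> u \<in> Substr T \<and>
     (prefix u T \<or> (\<exists>c d. c \<noteq> d \<and> c # u \<in> Substr T \<and> d # u \<in> Substr T))"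

definition right_maximal :: "'a list \<Rightarrow> 'a list \<Rightarrow> bool" where
  "right_maximal T u \<longleftrightarrow> u \<in> Substr T \<and>
     (suffix u T \<or> (\<exists>c d. c \<noteq> d \<and> u @ [c] \<in> Substr T \<and> u @ [d] \<in> Substr T))"

definition maximal_substrs :: "'a list \<Rightarrow> 'a list set" where
  "maximal_substrs T = {u. left_maximal T u \<and> right_maximal T u}"

definition out_degree :: "'a list \<Rightarrow> 'a list \<Rightarrow> nat" where
  "out_degree T w = card {c. w @ [c] \<in> Substr T}"

text \<open>The number of edges of $\mathrm{CDAWG}(T)$: its nodes are the elements of
  \<^term>\<open>maximal_substrs T\<close>, and the edges leaving the node \<^term>\<open>x\<close> correspond to the
  characters \<^term>\<open>c\<close> with \<^term>\<open>x @ [c] \<in> Substr T\<close>.\<close>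

definition cdawg_size :: "'a list \<Rightarrow> nat" where
  "cdawg_size T = (\<Sum>x\<in>maximal_substrs T. out_degree T x)"

text \<open>The change $|e(T[i..n]) - e(T[i+1..n])|$, $n = |T|$, in the number of edges when the
  CDAWG of $T[i+1..n]$ is updated to that of $T[i..n]$.\<close>

definition size_change :: "'a list \<Rightarrow> nat \<Rightarrow> int" where
  "size_change T i =
     \<bar>int (cdawg_size (factor T i (length T))) - int (cdawg_size (factor T (i + 1) (length T)))\<bar>"

text \<open>\<^term>\<open>W T i\<close> is the work spent on updating the CDAWG of $T[i+1..n]$ to that of
  $T[i..n]$. The only property of the construction procedure that is assumed is that an update
  costs at least the number of edges that have to be added or removed, hence at least
  \<^term>\<open>size_change T i\<close>. The step $i = n$ builds the CDAWG of $T[n..n]$ from scratch; its work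
  is only assumed to be nonnegative.\<close>

definition leftward_update_work :: "('a list \<Rightarrow> nat \<Rightarrow> nat) \<Rightarrow> bool" where
  "leftward_update_work W \<longleftrightarrow>
     (\<forall>T i. 1 \<le> i \<and> i < length T \<longrightarrow> size_change T i \<le> int (W T i))"

end

theory Submission
  imports Defs "HOL-Real_Asymp.Real_Asymp"
begin

text \<open>
  Let \<open>T = (ab)\<^sup>m c b (ab)\<^sup>m\<close> and consider its suffix \<open>U = (ab)\<^sup>k c b (ab)\<^sup>m\<close> with \<open>k < m\<close>. The words
  \<open>(ab)\<^sup>j\<close> with \<open>1 \<le> j \<le> k\<close> are maximal in \<open>U\<close> and have two outgoing edges: they are prefixes of
  \<open>U\<close>, and both \<open>a\<close> and \<open>c\<close> can follow them. In \<open>b U\<close> every \<open>a\<close> is preceded by \<open>b\<close>, so they all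
  cease to be left-maximal. On the other hand, prepending one character creates at most two new
  nodes, namely the whole word, which has no outgoing edge, and the longest prefix of \<open>b U\<close> that
  occurs in \<open>U\<close>, here \<open>b (ab)\<^sup>k\<close>. This prefix is left-maximal in \<open>U\<close>, so none of its own prefixes
  becomes a node, and it is the only old word that may gain an outgoing edge. Hence each such step
  loses at least \<open>2 k - 3\<close> edges, and summing over \<open>k\<close> gives a quadratic total.
\<close>

lemma finite_Substr: "finite (Substr T)"
  unfolding Substr_def by (metis List.finite_set set_sublists_eq)

lemma prefix_in_Substr: "prefix u v \<Longrightarrow> v \<in> Substr T \<Longrightarrow> u \<in> Substr T"
  unfolding Substr_def using prefix_imp_sublist sublist_order.order.trans by blast

lemma suffix_in_Substr: "suffix u v \<Longrightarrow> v \<in> Substr T \<Longrightarrow> u \<in> Substr T"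
  unfolding Substr_def using suffix_imp_sublist sublist_order.order.trans by blast

lemma Substr_Cons_iff: "u \<in> Substr (x # U) \<longleftrightarrow> prefix u (x # U) \<or> u \<in> Substr U"
  by (simp add: Substr_def sublist_Cons_right)

lemma successively_Substr:
  assumes "successively P T" "[y, z] \<in> Substr T"
  shows "P y z"
  using assms by (auto simp: Substr_def sublist_def successively_append_iff)

lemma suffix_if_snoc_in_Substr:
  assumes "z \<notin> set p" "z \<notin> set s" "u @ [z] \<in> Substr (p @ z # s)"
  shows "suffix u p"
proof -
  obtain q r where "p @ z # s = (q @ u) @ z # r"
    using assms(3) by (auto simp: Substr_def sublist_def)
  hence "p = q @ u"
    using assms(1,2) by (metis append_Cons_eq_iff)
  thus ?thesis by (rule suffixI)
qed

lemma extensions_subset_set: "{y. u @ [y] \<in> Substr T} \<subseteq> set T"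
  by (auto simp: Substr_def dest: set_mono_sublist)

lemma out_degree_le_card_set: "out_degree T u \<le> card (set T)"
  unfolding out_degree_def by (intro card_mono extensions_subset_set) simp

lemma card_le_out_degree:
  assumes "\<And>y. y \<in> Y \<Longrightarrow> u @ [y] \<in> Substr T"
  shows "card Y \<le> out_degree T u"
  unfolding out_degree_def
proof (rule card_mono)
  show "finite {y. u @ [y] \<in> Substr T}"
    by (rule finite_subset[OF extensions_subset_set]) simp
qed (use assms in blast)

lemma out_degree_self: "out_degree T T = 0"
proof -
  have "T @ [y] \<notin> Substr T" for y
    using sublist_length_le[of "T @ [y]" T] by (auto simp: Substr_def)
  thus ?thesis by (simp add: out_degree_def)
qed

lemma maximal_substrs_subset_Substr: "maximal_substrs T \<subseteq> Substr T"
  by (auto simp: maximal_substrs_def left_maximal_def)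

lemma finite_maximal_substrs: "finite (maximal_substrs T)"
  using maximal_substrs_subset_Substr finite_Substr by (rule finite_subset)

lemma left_maximal_prefix:
  assumes "left_maximal T w" "prefix v w"
  shows "left_maximal T v"
proof -
  have "y # v \<in> Substr T" if "y # w \<in> Substr T" for y
    using prefix_in_Substr[OF _ that] assms(2) by simp
  moreover have "v \<in> Substr T"
    using assms prefix_in_Substr by (auto simp: left_maximal_def)
  ultimately show ?thesis
    using assms prefix_order.trans unfolding left_maximal_def by blast
qed

lemma left_maximal_unique_predecessor_imp_prefix:
  assumes "left_maximal T (x # u)" "successively (\<lambda>y z. z = x \<longrightarrow> y = x') T"
  shows "prefix (x # u) T"
proof -
  have "y = x'" if "y # x # u \<in> Substr T" for y
    using successively_Substr[OF assms(2), of y x] prefix_in_Substr[OF _ that, of "[y, x]"]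
    by simp
  thus ?thesis using assms(1) unfolding left_maximal_def by blast
qed

definition longest_recurring_prefix :: "'a \<Rightarrow> 'a list \<Rightarrow> 'a list \<Rightarrow> bool" where
  "longest_recurring_prefix x U w \<longleftrightarrow> prefix w (x # U) \<and> w \<in> Substr U \<and>
     (\<forall>v. prefix v (x # U) \<and> v \<in> Substr U \<longrightarrow> prefix v w)"

lemma longest_recurring_prefixI:
  assumes "prefix (w @ [z]) (x # U)" "w \<in> Substr U" "w @ [z] \<notin> Substr U"
  shows "longest_recurring_prefix x U w"
proof -
  have "prefix v w" if "prefix v (x # U)" "v \<in> Substr U" for v
  proof -
    have "\<not> prefix (w @ [z]) v"
      using that(2) assms(3) prefix_in_Substr by blast
    hence "prefix v (w @ [z])" "v \<noteq> w @ [z]"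
      using prefix_same_cases[OF that(1) assms(1)] by auto
    thus ?thesis by simp
  qed
  thus ?thesis
    using append_prefixD[OF assms(1)] assms(2) by (simp add: longest_recurring_prefix_def)
qed

lemma extension_in_Substr_Cons_iff:
  assumes "longest_recurring_prefix x U w" "u \<in> Substr U" "u \<noteq> w"
  shows "u @ [y] \<in> Substr (x # U) \<longleftrightarrow> u @ [y] \<in> Substr U"
proof
  assume "u @ [y] \<in> Substr (x # U)"
  then consider (old) "u @ [y] \<in> Substr U" | (initial) "prefix (u @ [y]) (x # U)"
    unfolding Substr_Cons_iff by blast
  thus "u @ [y] \<in> Substr U"
  proof cases
    case initial
    have w: "prefix w (x # U)" "w \<in> Substr U"
      using assms(1) by (simp_all add: longest_recurring_prefix_def)
    have "prefix u w"
      using append_prefixD[OF initial] assms(1,2) by (simp add: longest_recurring_prefix_def)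
    hence "length u < length w"
      using assms(3) by (simp add: prefix_length_less)
    hence "prefix (u @ [y]) w"
      by (intro prefix_length_prefix[OF initial w(1)]) simp
    thus ?thesis using w(2) by (rule prefix_in_Substr)
  qed
qed (simp add: Substr_Cons_iff)

lemma out_degree_Cons:
  assumes "longest_recurring_prefix x U w" "u \<in> Substr U" "u \<noteq> w"
  shows "out_degree (x # U) u = out_degree U u"
  using extension_in_Substr_Cons_iff[OF assms] by (simp add: out_degree_def)

lemma right_maximal_Cons_notin_Substr:
  assumes "right_maximal (x # U) u" "u \<notin> Substr U"
  shows "u = x # U"
proof (rule ccontr)
  assume "u \<noteq> x # U"
  hence "\<not> suffix u (x # U)"
    using assms(2) by (auto simp: suffix_Cons Substr_def)
  then obtain y z where "y \<noteq> z" and ext: "u @ [y] \<in> Substr (x # U)" "u @ [z] \<in> Substr (x # U)"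
    using assms(1) by (auto simp: right_maximal_def)
  have "u @ [v] \<notin> Substr U" for v
    using assms(2) prefix_in_Substr[of u "u @ [v]" U] by auto
  hence "prefix (u @ [y]) (x # U)" "prefix (u @ [z]) (x # U)"
    using ext by (simp_all add: Substr_Cons_iff)
  hence "u @ [y] = u @ [z]"
    using prefix_length_prefix[of "u @ [y]" "x # U" "u @ [z]"] by simp
  with \<open>y \<noteq> z\<close> show False by simp
qed

lemma right_maximal_ConsD:
  assumes "longest_recurring_prefix x U w" "u \<in> Substr U" "u \<noteq> w" "u \<noteq> x # U"
    and "right_maximal (x # U) u"
  shows "right_maximal U u"
  using assms(2,4,5) extension_in_Substr_Cons_iff[OF assms(1-3)]
  by (simp add: right_maximal_def suffix_Cons)

lemma left_maximal_ConsD: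
  assumes "longest_recurring_prefix x U w" "left_maximal U w" "u \<in> Substr U"
    and "left_maximal (x # U) u"
  shows "left_maximal U u"
proof (cases "prefix u (x # U)")
  case True
  hence "prefix u w"
    using assms(1,3) by (simp add: longest_recurring_prefix_def)
  with assms(2) show ?thesis by (rule left_maximal_prefix)
next
  case False
  then obtain y z where "y \<noteq> z" "y # u \<in> Substr (x # U)" "z # u \<in> Substr (x # U)"
    using assms(4) by (auto simp: left_maximal_def)
  thus ?thesis
    using assms(3) by (auto simp: left_maximal_def Substr_Cons_iff)
qed

lemma maximal_substrs_Cons_subset:
  assumes "longest_recurring_prefix x U w" "left_maximal U w"
  shows "maximal_substrs (x # U) \<subseteq> insert w (insert (x # U) (maximal_substrs U))"
proof
  fix u assume "u \<in> maximal_substrs (x # U)"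
  hence max: "left_maximal (x # U) u" "right_maximal (x # U) u"
    by (simp_all add: maximal_substrs_def)
  show "u \<in> insert w (insert (x # U) (maximal_substrs U))"
  proof (cases "u = w \<or> u = x # U")
    case False
    have "u \<in> Substr U"
      using right_maximal_Cons_notin_Substr[OF max(2)] False by blast
    hence "left_maximal U u" "right_maximal U u"
      using left_maximal_ConsD[OF assms] right_maximal_ConsD[OF assms(1)] max False
      by blast+
    thus ?thesis by (simp add: maximal_substrs_def)
  qed blast
qed

lemma cdawg_size_Cons_le:
  assumes "longest_recurring_prefix x U w" and "left_maximal U w"
  shows "cdawg_size (x # U) + (\<Sum>u\<in>maximal_substrs U - maximal_substrs (x # U). out_degree U u)
    \<le> cdawg_size U + out_degree (x # U) w"
proof -
  let ?M = "maximal_substrs (x # U)" and ?N = "maximal_substrs U"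
  let ?kept = "?M \<inter> ?N - {w, x # U}"
  have "?M \<subseteq> ?kept \<union> {w, x # U}"
    using maximal_substrs_Cons_subset[OF assms] by blast
  hence "cdawg_size (x # U) \<le> sum (out_degree (x # U)) (?kept \<union> {w, x # U})"
    unfolding cdawg_size_def by (intro sum_mono2) (simp_all add: finite_maximal_substrs)
  also have "\<dots> = sum (out_degree (x # U)) ?kept + sum (out_degree (x # U)) {w, x # U}"
    by (intro sum.union_disjoint) (auto simp: finite_maximal_substrs)
  also have "sum (out_degree (x # U)) {w, x # U} = out_degree (x # U) w"
    by (cases "w = x # U") (simp_all add: out_degree_self)
  also have "sum (out_degree (x # U)) ?kept = sum (out_degree U) ?kept"
    using maximal_substrs_subset_Substr[of U]
    by (intro sum.cong refl out_degree_Cons[OF assms(1)]) auto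
  finally have "cdawg_size (x # U) \<le> sum (out_degree U) ?kept + out_degree (x # U) w" .
  moreover have "sum (out_degree U) ?kept + sum (out_degree U) (?N - ?M)
      = sum (out_degree U) (?kept \<union> (?N - ?M))"
    by (intro sum.union_disjoint[symmetric]) (auto simp: finite_maximal_substrs)
  moreover have "\<dots> \<le> cdawg_size U"
    unfolding cdawg_size_def by (intro sum_mono2) (auto simp: finite_maximal_substrs)
  ultimately show ?thesis by linarith
qed

definition word_power :: "'a list \<Rightarrow> nat \<Rightarrow> 'a list" where
  "word_power u k = concat (replicate k u)"

lemma word_power_0 [simp]: "word_power u 0 = []"
  and word_power_Suc [simp]: "word_power u (Suc k) = u @ word_power u k"
  by (simp_all add: word_power_def)

lemma word_power_add: "word_power u (i + j) = word_power u i @ word_power u j"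
  by (simp add: word_power_def replicate_add)

lemma length_word_power [simp]: "length (word_power u k) = k * length u"
  by (induction k) simp_all

lemma set_word_power_subset: "set (word_power u k) \<subseteq> set u"
  by (auto simp: word_power_def)

lemma prefix_word_power: "i \<le> j \<Longrightarrow> prefix (word_power u i) (word_power u j)"
  by (metis le_Suc_ex prefixI word_power_add)

lemma suffix_word_power: "i \<le> j \<Longrightarrow> suffix (word_power u i) (word_power u j)"
  by (metis add.commute le_Suc_ex suffixI word_power_add)

lemma inj_word_power: "u \<noteq> [] \<Longrightarrow> inj (word_power u)"
  by (metis injI length_word_power length_0_conv mult_cancel2)

definition two_runs :: "'a \<Rightarrow> 'a \<Rightarrow> 'a \<Rightarrow> nat \<Rightarrow> nat \<Rightarrow> 'a list" where
  "two_runs a b c k m = word_power [a, b] k @ c # b # word_power [a, b] m"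

lemma length_two_runs [simp]: "length (two_runs a b c k m) = 2 * k + 2 * m + 2"
  by (simp add: two_runs_def)

lemma set_two_runs_subset: "set (two_runs a b c k m) \<subseteq> {a, b, c}"
  using set_word_power_subset[of "[a, b]"] by (fastforce simp: two_runs_def)

lemma two_runs_add: "two_runs a b c (i + k) m = word_power [a, b] i @ two_runs a b c k m"
  by (simp add: two_runs_def word_power_add)

lemma word_power_in_Substr_two_runs:
  assumes "j \<le> m"
  shows "word_power [a, b] j \<in> Substr (two_runs a b c k m)"
proof (rule suffix_in_Substr[OF suffix_word_power[OF assms]])
  show "word_power [a, b] m \<in> Substr (two_runs a b c k m)"
    by (simp add: Substr_def two_runs_def sublist_append sublist_Cons_right)
qed

lemma word_power_snoc_in_Substr_two_runs:
  assumes "j \<le> k" "j < m" "y \<in> {a, c}"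
  shows "word_power [a, b] j @ [y] \<in> Substr (two_runs a b c k m)"
proof (cases "y = a")
  case True
  have "word_power [a, b] (Suc j) = (word_power [a, b] j @ [a]) @ [b]"
    using word_power_add[of "[a, b]" j 1] by simp
  hence "prefix (word_power [a, b] j @ [a]) (word_power [a, b] (Suc j))"
    by (rule prefixI)
  thus ?thesis
    using word_power_in_Substr_two_runs[of "Suc j" m] assms(2) prefix_in_Substr True by fastforce
next
  case False
  obtain p where "word_power [a, b] k = p @ word_power [a, b] j"
    using suffix_word_power[OF assms(1)] by (rule suffixE)
  hence "two_runs a b c k m = p @ (word_power [a, b] j @ [c]) @ b # word_power [a, b] m"
    by (simp add: two_runs_def)
  moreover have "y = c" using assms(3) False by simp
  ultimately show ?thesis
    unfolding Substr_def by (metis mem_Collect_eq sublist_appendI)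
qed

lemma word_power_in_maximal_substrs:
  assumes "a \<noteq> c" "j \<le> k" "k < m"
  shows "word_power [a, b] j \<in> maximal_substrs (two_runs a b c k m)"
proof -
  let ?v = "word_power [a, b] j" and ?U = "two_runs a b c k m"
  have "prefix ?v ?U"
    unfolding two_runs_def by (rule prefix_prefix) (rule prefix_word_power[OF assms(2)])
  moreover have "?v @ [a] \<in> Substr ?U" "?v @ [c] \<in> Substr ?U"
    using assms by (simp_all add: word_power_snoc_in_Substr_two_runs)
  moreover have "?v \<in> Substr ?U"
    using assms by (simp add: word_power_in_Substr_two_runs)
  ultimately show ?thesis
    using assms(1) unfolding maximal_substrs_def left_maximal_def right_maximal_def by blast
qed

lemma successively_Cons_word_power_append:
  assumes "a \<noteq> b"
  shows "successively (\<lambda>y z. z = a \<longrightarrow> y = b) (b # word_power [a, b] k @ v) \<longleftrightarrow>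
    successively (\<lambda>y z. z = a \<longrightarrow> y = b) (b # v)"
  using assms by (induction k) auto

lemma word_power_notin_maximal_substrs_Cons:
  assumes "distinct [a, b, c]" "0 < j"
  shows "word_power [a, b] j \<notin> maximal_substrs (b # two_runs a b c k m)"
proof
  assume max: "word_power [a, b] j \<in> maximal_substrs (b # two_runs a b c k m)"
  obtain u where u: "word_power [a, b] j = a # u"
    using assms(2) by (cases j) auto
  have "successively (\<lambda>y z. z = a \<longrightarrow> y = b) (b # two_runs a b c k m)"
    using assms(1) successively_Cons_word_power_append[of a b m "[]"]
    by (auto simp: two_runs_def successively_Cons_word_power_append)
  moreover have "left_maximal (b # two_runs a b c k m) (a # u)"
    using max by (simp add: maximal_substrs_def u)
  ultimately have "prefix (a # u) (b # two_runs a b c k m)"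
    by (intro left_maximal_unique_predecessor_imp_prefix)
  thus False using assms(1) by simp
qed

lemma left_maximal_Cons_word_power:
  assumes "a \<noteq> c" "k < m"
  shows "left_maximal (two_runs a b c k m) (b # word_power [a, b] k)"
proof -
  let ?w = "b # word_power [a, b] k" and ?U = "two_runs a b c k m"
  have "a # ?w \<in> Substr ?U"
    using word_power_in_Substr_two_runs[of "Suc k" m a b c k] assms(2) by simp
  moreover have "c # ?w \<in> Substr ?U"
  proof (rule prefix_in_Substr)
    show "prefix (c # ?w) (c # b # word_power [a, b] m)"
      using assms(2) by (simp add: prefix_word_power)
    show "c # b # word_power [a, b] m \<in> Substr ?U"
      by (simp add: Substr_def two_runs_def)
  qed
  moreover from this have "?w \<in> Substr ?U"
    by (rule suffix_in_Substr[rotated]) (simp add: suffix_ConsI)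
  ultimately show ?thesis
    using assms(1) by (auto simp: left_maximal_def)
qed

lemma longest_recurring_prefix_two_runs:
  assumes "distinct [a, b, c]" "k < m"
  shows "longest_recurring_prefix b (two_runs a b c k m) (b # word_power [a, b] k)"
proof (rule longest_recurring_prefixI)
  let ?w = "b # word_power [a, b] k" and ?U = "two_runs a b c k m"
  show "prefix (?w @ [c]) (b # ?U)" by (simp add: two_runs_def)
  show "?w \<in> Substr ?U"
    using left_maximal_Cons_word_power[of a c k m b] assms by (simp add: left_maximal_def)
  show "?w @ [c] \<notin> Substr ?U"
  proof
    assume "?w @ [c] \<in> Substr ?U"
    moreover have "c \<notin> set (word_power [a, b] k)" "c \<notin> set (b # word_power [a, b] m)"
      using assms(1) set_word_power_subset[of "[a, b]"] by auto
    ultimately have "suffix ?w (word_power [a, b] k)"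
      unfolding two_runs_def by (intro suffix_if_snoc_in_Substr)
    thus False using suffix_length_le by fastforce
  qed
qed

lemma cdawg_size_Cons_two_runs:
  assumes "distinct [a, b, c]" "k < m"
  shows "cdawg_size (b # two_runs a b c k m) + 2 * k \<le> cdawg_size (two_runs a b c k m) + 3"
proof -
  let ?w = "b # word_power [a, b] k" and ?U = "two_runs a b c k m"
  let ?lost = "maximal_substrs ?U - maximal_substrs (b # ?U)"
  have "2 * k = 2 * card (word_power [a, b] ` {1..k})"
    by (simp add: card_image inj_on_subset[OF inj_word_power])
  also have "\<dots> = (\<Sum>v\<in>word_power [a, b] ` {1..k}. card {a, c})"
    using assms(1) by simp
  also have "\<dots> \<le> (\<Sum>v\<in>word_power [a, b] ` {1..k}. out_degree ?U v)"
    using assms(2)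
    by (intro sum_mono card_le_out_degree) (auto intro: word_power_snoc_in_Substr_two_runs)
  also have "\<dots> \<le> (\<Sum>v\<in>?lost. out_degree ?U v)"
    using assms word_power_in_maximal_substrs[of a c _ k m b]
      word_power_notin_maximal_substrs_Cons[OF assms(1)]
    by (intro sum_mono2) (auto simp: finite_maximal_substrs)
  finally have "2 * k \<le> (\<Sum>v\<in>?lost. out_degree ?U v)" .
  moreover have "cdawg_size (b # ?U) + (\<Sum>v\<in>?lost. out_degree ?U v)
      \<le> cdawg_size ?U + out_degree (b # ?U) ?w"
    using assms by (intro cdawg_size_Cons_le longest_recurring_prefix_two_runs
      left_maximal_Cons_word_power) auto
  moreover have "out_degree (b # ?U) ?w \<le> 3"
  proof -
    have "card (set (b # ?U)) \<le> card {a, b, c}"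
      using set_two_runs_subset[of a b c k m] by (intro card_mono) auto
    also have "\<dots> \<le> 3" by (simp add: card_insert_if)
    finally show ?thesis using out_degree_le_card_set order_trans by blast
  qed
  ultimately show ?thesis by linarith
qed

lemma size_change_append:
  "size_change (p @ x # U) (Suc (length p)) = \<bar>int (cdawg_size (x # U)) - int (cdawg_size U)\<bar>"
  by (simp add: size_change_def factor_def)

lemma size_change_two_runs:
  assumes "distinct [a, b, c]" "k < m"
  shows "2 * int k - 3 \<le> size_change (two_runs a b c m m) (2 * (m - k))"
proof -
  let ?U = "two_runs a b c k m" and ?p = "word_power [a, b] (m - Suc k) @ [a]"
  have "two_runs a b c m m = two_runs a b c ((m - Suc k) + Suc k) m"
    using assms(2) by simp
  also have "\<dots> = ?p @ b # ?U"
    unfolding two_runs_add by (simp add: two_runs_def)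
  finally have "two_runs a b c m m = ?p @ b # ?U" .
  moreover have "2 * (m - k) = Suc (length ?p)"
    using assms(2) by simp
  ultimately have "size_change (two_runs a b c m m) (2 * (m - k)) =
      \<bar>int (cdawg_size (b # ?U)) - int (cdawg_size ?U)\<bar>"
    by (metis size_change_append)
  thus ?thesis using cdawg_size_Cons_two_runs[OF assms] by linarith
qed

definition total_size_change :: "'a list \<Rightarrow> int" where
  "total_size_change T = (\<Sum>i = 1..length T - 1. size_change T i)"

lemma size_change_nonneg: "0 \<le> size_change T i"
  by (simp add: size_change_def)

lemma total_size_change_nonneg: "0 \<le> total_size_change T"
  unfolding total_size_change_def by (intro sum_nonneg size_change_nonneg)

lemma total_size_change_le_work:
  assumes "leftward_update_work W"
  shows "total_size_change T \<le> int (\<Sum>i = 1..length T. W T i)"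
proof -
  have "total_size_change T \<le> (\<Sum>i = 1..length T - 1. int (W T i))"
    using assms unfolding total_size_change_def leftward_update_work_def
    by (intro sum_mono) auto
  also have "\<dots> \<le> (\<Sum>i = 1..length T. int (W T i))"
    by (intro sum_mono2) auto
  finally show ?thesis by simp
qed

lemma work_bigomega_total_size_change:
  assumes "leftward_update_work W"
  shows "(\<lambda>m. real (\<Sum>i = 1..length (T m). W (T m) i))
    \<in> \<Omega>[F](\<lambda>m. real_of_int (total_size_change (T m)))"
proof (intro landau_omega.big_mono always_eventually allI)
  fix m
  show "norm (real_of_int (total_size_change (T m)))
      \<le> norm (real (\<Sum>i = 1..length (T m). W (T m) i))"
    using total_size_change_le_work[OF assms, of "T m"] total_size_change_nonneg[of "T m"]
    unfolding real_norm_def by linarith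
qed

lemma total_size_change_two_runs:
  assumes "distinct [a, b, c]"
  shows "int m * (int m - 4) \<le> total_size_change (two_runs a b c m m)"
proof -
  let ?T = "two_runs a b c m m"
  have "int m * (int m - 4) = (\<Sum>k<m. 2 * int k - 3)"
    by (induction m) (simp_all add: algebra_simps)
  also have "\<dots> \<le> (\<Sum>k<m. size_change ?T (2 * (m - k)))"
    by (intro sum_mono size_change_two_runs[OF assms]) simp
  also have "\<dots> = sum (size_change ?T) ((\<lambda>k. 2 * (m - k)) ` {..<m})"
    by (subst sum.reindex) (auto simp: inj_on_def)
  also have "\<dots> \<le> total_size_change ?T"
    unfolding total_size_change_def by (intro sum_mono2) (auto simp: size_change_nonneg)
  finally show ?thesis .
qed

lemma total_size_change_two_runs_bigomega:
  assumes "distinct [a, b, c]"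
  shows "(\<lambda>m. real_of_int (total_size_change (two_runs a b c m m)))
    \<in> \<Omega>(\<lambda>m. real (length (two_runs a b c m m)) ^ 2)"
proof -
  have length: "real (length (two_runs a b c m m)) = 4 * real m + 2" for m by simp
  have "(\<lambda>m. real m * (real m - 4)) \<in> \<Omega>(\<lambda>m. real (length (two_runs a b c m m)) ^ 2)"
    unfolding length by real_asymp
  moreover have "(\<lambda>m. real_of_int (total_size_change (two_runs a b c m m)))
      \<in> \<Omega>(\<lambda>m. real m * (real m - 4))"
  proof (rule landau_omega.big_mono)
    show "\<forall>\<^sub>F m in sequentially. norm (real m * (real m - 4))
      \<le> norm (real_of_int (total_size_change (two_runs a b c m m)))"
      using eventually_ge_at_top[of 4]
    proof eventually_elim
      case (elim m)
      have "real_of_int (int m * (int m - 4))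
          \<le> real_of_int (total_size_change (two_runs a b c m m))"
        unfolding of_int_le_iff by (rule total_size_change_two_runs[OF assms])
      with elim show ?case by simp
    qed
  qed
  ultimately show ?thesis by (rule landau_omega.big_trans[rotated])
qed

theorem theorem7:
  fixes Sigma :: "'a set" and a b c d :: 'a
  assumes "distinct [a, b, c, d]" and "{a, b, c, d} \<subseteq> Sigma"
  shows "\<exists>T :: nat \<Rightarrow> 'a list.
    (\<forall>m\<ge>1. set (T m) \<subseteq> Sigma) \<and>
    filterlim (\<lambda>m. length (T m)) at_top sequentially \<and>
    (\<lambda>m. real_of_int (\<Sum>i = 1..length (T m) - 1. size_change (T m) i))
      \<in> \<Omega>[sequentially](\<lambda>m. real (length (T m)) ^ 2) \<and>
    (\<forall>W. leftward_update_work W \<longrightarrow>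
      (\<lambda>m. real (\<Sum>i = 1..length (T m). W (T m) i))
        \<in> \<Omega>[sequentially](\<lambda>m. real (length (T m)) ^ 2))"
proof (intro exI conjI allI impI)
  let ?T = "\<lambda>m. two_runs a b c m m"
  show "set (?T m) \<subseteq> Sigma" for m
    using set_two_runs_subset[of a b c m m] assms(2) by auto
  show "filterlim (\<lambda>m. length (?T m)) at_top sequentially"
    by (rule filterlim_at_top_mono[OF filterlim_ident]) simp
  have total: "(\<lambda>m. real_of_int (total_size_change (?T m))) \<in> \<Omega>(\<lambda>m. real (length (?T m)) ^ 2)"
    using assms(1) by (intro total_size_change_two_runs_bigomega) simp
  thus "(\<lambda>m. real_of_int (\<Sum>i = 1..length (?T m) - 1. size_change (?T m) i))
      \<in> \<Omega>(\<lambda>m. real (length (?T m)) ^ 2)"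
    unfolding total_size_change_def .
  fix W :: "'a list \<Rightarrow> nat \<Rightarrow> nat" assume "leftward_update_work W"
  thus "(\<lambda>m. real (\<Sum>i = 1..length (?T m). W (?T m) i)) \<in> \<Omega>(\<lambda>m. real (length (?T m)) ^ 2)"
    by (rule landau_omega.big_trans[OF work_bigomega_total_size_change total])
qed

end
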